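(* Let $K$ be a field and $\tau$ a field topology on $K$ that is bronze t-henselian (bt-henselian). Then $K$ is large.
   Context: A field topology on $K$ is a Hausdorff, non-discrete topology on $K$ in which addition, negation, multiplication and inversion (on $K^\times$) are continuous. Let $K[X]^d_1$ be the set of monic polynomials of degree $d$ over $K$, topologized by identification with $K^d$ via coefficients. $\tau$ is bronze t-henselian if: whenever $Q\in K[X]^d_1$ is separable and has a root in $K$, there is a neighborhood $V$ of $Q$ in $K[X]^d_1$ such that every $P\in V$ has a root in $K$. $K$ is large if for every polynomial $P(x,y)\in K[x,y]$ and $(a,b)\in K^2$ with $P(a,b)=0\neq\frac{\partial P}{\partial y}(a,b)$, the set $\{(x,y)\in K^2:P(x,y)=0\}$ is infinite. *)

theory Defs
  imports
    "HOL-Analysis.Analysis"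
    "HOL-Computational_Algebra.Computational_Algebra"
begin

definition field_topology :: "'a::field topology \<Rightarrow> bool" where
  "field_topology T \<longleftrightarrow>
     topspace T = UNIV \<and>
     Hausdorff_space T \<and>
     T \<noteq> discrete_topology UNIV \<and>
     continuous_map (prod_topology T T) T (\<lambda>(x, y). x + y) \<and>
     continuous_map T T uminus \<and>
     continuous_map (prod_topology T T) T (\<lambda>(x, y). x * y) \<and>
     continuous_map (subtopology T (UNIV - {0})) T inverse"

definition monic_polys :: "nat \<Rightarrow> 'a::field poly set" where
  "monic_polys d = {P. degree P = d \<and> lead_coeff P = 1}"

text \<open>
  The map \<open>P \<mapsto> (coeff P 0, \<dots>, coeff P (d - 1))\<close> is a bijection from the monic
  polynomials of degree \<open>d\<close> onto \<open>{..<d} \<rightarrow>\<^sub>E UNIV\<close>, the underlying set of the product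
  space. The topology is transported along this bijection; its underlying set is
  \<open>monic_polys d\<close>.
\<close>

definition monic_topology :: "'a::field topology \<Rightarrow> nat \<Rightarrow> 'a poly topology" where
  "monic_topology T d =
     pullback_topology (monic_polys d) (\<lambda>P. restrict (coeff P) {..<d})
       (product_topology (\<lambda>_. T) {..<d})"

definition separable_poly :: "'a::field poly \<Rightarrow> bool" where
  "separable_poly P \<longleftrightarrow> coprime P (pderiv P)"

definition bronze_t_henselian :: "'a::field topology \<Rightarrow> bool" where
  "bronze_t_henselian T \<longleftrightarrow>
     (\<forall>d. \<forall>Q \<in> monic_polys d. separable_poly Q \<and> (\<exists>x. poly Q x = 0) \<longrightarrow>
        (\<exists>V. openin (monic_topology T d) V \<and> Q \<in> V \<and> (\<forall>P\<in>V. \<exists>x. poly P x = 0)))"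

text \<open>
  A polynomial in \<open>K[x, y]\<close> is represented as an element of \<open>K[x][y]\<close>: the outer
  variable is \<open>y\<close>, so \<^const>\<open>pderiv\<close> on the outer level is the partial derivative
  with respect to \<open>y\<close>.
\<close>

definition eval2 :: "'a::field poly poly \<Rightarrow> 'a \<Rightarrow> 'a \<Rightarrow> 'a" where
  "eval2 P x y = poly (poly P [:y:]) x"

definition large_field :: "'a::field itself \<Rightarrow> bool" where
  "large_field _ \<longleftrightarrow>
     (\<forall>(P :: 'a poly poly) a b. eval2 P a b = 0 \<and> eval2 (pderiv P) a b \<noteq> 0 \<longrightarrow>
        infinite {(x, y). eval2 P x y = 0})"

end

theory Submission
  imports Defs
begin

text \<open>
  Replacing \<open>P\<close> by an irreducible factor that is smooth at \<open>(a, b)\<close>, cut the curve with the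
  parabolas \<open>y = g(x) = b + m (x - a) + s (x - a)\<^sup>2\<close> through \<open>(a, b)\<close>. The multiple roots of
  \<open>P(x, g(x))\<close> other than \<open>a\<close> are common zeros of \<open>P\<close> and
  \<open>D\<^sub>m = (x - a) P\<^sub>x + (2 (y - b) - m (x - a)) P\<^sub>y\<close>, where \<open>s\<close> has been eliminated. Since
  \<open>D\<^sub>m - D\<^sub>n = (n - m) (x - a) P\<^sub>y\<close>, for all but one \<open>m\<close> the polynomials \<open>P\<close> and \<open>D\<^sub>m\<close> are
  coprime in every characteristic, so they have finitely many common zeros, and each of them with
  \<open>x \<noteq> a\<close> lies on only one of the parabolas. Hence a generic parabola gives a separable polynomial with the root
  \<open>a\<close>. The translates \<open>y = g(x) + t\<close> give polynomials with the same leading term and with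
  coefficients continuous in \<open>t\<close>, so they have roots for all \<open>t\<close> in a neighbourhood of \<open>0\<close>,
  which is infinite; distinct \<open>t\<close> give distinct points of the curve.
\<close>

subsection \<open>Prime factors and Gauss's lemma over a field\<close>

lemma field_poly_prime_divisor_exists:
  fixes p :: "'a::field poly"
  assumes "p \<noteq> 0" "\<not> is_unit p"
  shows "\<exists>q. prime_elem q \<and> q dvd p"
  using assms
proof (induction "degree p" arbitrary: p rule: less_induct)
  case less
  show ?case
  proof (cases "irreducible p")
    case True
    then show ?thesis using field_poly_irreducible_imp_prime dvd_refl by metis
  next
    case False
    then obtain a b where ab: "p = a * b" "\<not> is_unit a" "\<not> is_unit b"
      using less.prems False irreducibleI by metis
    have nz: "a \<noteq> 0" "b \<noteq> 0" using ab less.prems by auto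
    then have "degree b > 0" using ab is_unit_iff_degree by blast
    then have "degree a < degree p" using nz ab by (simp add: degree_mult_eq)
    then show ?thesis using less.hyps[of a] nz ab by (meson dvd_trans dvd_triv_left)
  qed
qed

text \<open>Allows a nonzero constant from \<open>K[x]\<close> to be stripped of its prime factors
  one at a time when denominators are cleared.\<close>

lemma field_poly_prime_induct [consumes 1, case_names unit prime]:
  fixes p :: "'a::field poly"
  assumes "p \<noteq> 0"
    and unit: "\<And>u. is_unit u \<Longrightarrow> R u"
    and prime: "\<And>q p. prime_elem q \<Longrightarrow> p \<noteq> 0 \<Longrightarrow> R p \<Longrightarrow> R (q * p)"
  shows "R p"
  using assms(1)
proof (induction "degree p" arbitrary: p rule: less_induct)
  case less
  show ?case
  proof (cases "is_unit p")
    case False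
    then obtain q p' where q: "prime_elem q" "p = q * p'"
      using field_poly_prime_divisor_exists less.prems by (metis dvdE)
    have nz: "q \<noteq> 0" "p' \<noteq> 0" using q less.prems by auto
    moreover have "degree q > 0"
      using q nz is_unit_iff_degree by (metis gr0I prime_elem_not_unit)
    ultimately have "degree p' < degree p" using q by (simp add: degree_mult_eq)
    then show ?thesis using less.hyps q nz prime by blast
  qed (rule unit)
qed

text \<open>The cofactor of \<open>[:q:]\<close> would have to be a unit, hence constant in
  \<open>y\<close>, against the positive degree of \<open>P\<close>.\<close>

lemma irreducible_not_prime_const_dvd:
  fixes P :: "'a::field poly poly"
  assumes "irreducible P" "degree P > 0" "prime_elem q"
  shows "\<not> [:q:] dvd P"
proof
  assume "[:q:] dvd P"
  then obtain R where R: "P = [:q:] * R" by (elim dvdE)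
  have "\<not> is_unit [:q:]" using assms(3) by (simp add: is_unit_const_poly_iff prime_elem_def)
  then have "is_unit R" using irreducibleD[OF assms(1) R] by blast
  then have "degree R = 0" by (auto simp: is_unit_poly_iff)
  then show False using R assms(2) by (simp split: if_splits)
qed

text \<open>A prime \<open>q\<close> of \<open>K[x]\<close> stays prime in \<open>K[x][y]\<close>
  and does not divide \<open>P\<close>, so it divides the cofactor of \<open>P\<close> and can be
  cancelled.\<close>

lemma irreducible_dvd_smult_cancel:
  fixes P :: "'a::field poly poly"
  assumes "irreducible P" "degree P > 0" "c \<noteq> 0" "P dvd smult c D"
  shows "P dvd D"
  using assms(3,4)
proof (induction c arbitrary: D rule: field_poly_prime_induct)
  case (unit u)
  then obtain v where "1 = u * v" by (elim dvdE)
  then have "D = smult v (smult u D)" by (simp add: mult.commute)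
  then show ?case using unit by (metis dvd_smult)
next
  case (prime q c)
  then have "P dvd smult c (smult q D)" by (simp add: mult.commute)
  then have "P dvd smult q D" by (rule prime.IH)
  then obtain H where H: "[:q:] * D = P * H" by (auto elim: dvdE)
  have pr: "prime_elem [:q:]" using prime by (simp add: lift_prime_elem_poly)
  have "[:q:] dvd P * H" by (metis H dvd_triv_left)
  then have "[:q:] dvd H"
    using prime_elem_dvd_multD[OF pr] irreducible_not_prime_const_dvd assms(1,2) prime.hyps by blast
  then obtain H' where "H = [:q:] * H'" by (elim dvdE)
  then have "[:q:] * D = [:q:] * (P * H')" using H by (simp add: mult_ac)
  moreover have "[:q:] \<noteq> 0" using pr by (rule prime_elem_not_zeroI)
  ultimately have "D = P * H'" by (metis mult_left_cancel)
  then show ?case by simp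
qed

text \<open>Gauss's lemma with denominators cleared: \<open>P\<close> has no proper factorization
  over \<open>K(x)\<close>. Each prime of \<open>c\<close> divides \<open>Q\<close> or
  \<open>G\<close> and is cancelled there.\<close>

lemma irreducible_smult_eq_mult:
  fixes P :: "'a::field poly poly"
  assumes "irreducible P" "c \<noteq> 0" "smult c P = Q * G"
  shows "degree Q = 0 \<or> degree G = 0"
  using assms(2,3)
proof (induction c arbitrary: Q G rule: field_poly_prime_induct)
  case (unit u)
  then obtain v where v: "1 = u * v" by (elim dvdE)
  then have v0: "v \<noteq> 0" by auto
  have "P = smult v (smult u P)" using v by (simp add: mult.commute)
  then have "P = smult v Q * G" using unit by simp
  then have "is_unit (smult v Q) \<or> is_unit G" using assms(1) irreducibleD by blast
  then have "degree (smult v Q) = 0 \<or> degree G = 0" by (metis degree_pCons_0 is_unit_poly_iff)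
  then show ?case using v0 by simp
next
  case (prime q c)
  have pr: "prime_elem [:q:]" using prime by (simp add: lift_prime_elem_poly)
  have q0: "q \<noteq> 0" using prime by auto
  have eq: "[:q:] * smult c P = Q * G" using prime.prems by (simp add: mult.commute)
  then have "[:q:] dvd Q \<or> [:q:] dvd G" using prime_elem_dvd_multD[OF pr] by (metis dvd_triv_left)
  then show ?case
  proof
    assume "[:q:] dvd Q"
    then obtain Q' where Q': "Q = [:q:] * Q'" by (elim dvdE)
    then have "[:q:] * smult c P = [:q:] * (Q' * G)" using eq by (simp only: mult_ac)
    then have "smult c P = Q' * G" using q0 by (subst (asm) mult_left_cancel) auto
    then show ?case using prime.IH[of Q' G] Q' q0 by simp
  next
    assume "[:q:] dvd G"
    then obtain G' where G': "G = [:q:] * G'" by (elim dvdE)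
    then have "[:q:] * smult c P = [:q:] * (Q * G')" using eq by (simp only: mult_ac)
    then have "smult c P = Q * G'" using q0 by (subst (asm) mult_left_cancel) auto
    then show ?case using prime.IH[of Q G'] G' q0 by simp
  qed
qed

text \<open>The Bezout identity of \<open>K(x)[y]\<close> with denominators cleared: a common
  divisor of positive degree in \<open>y\<close> would be an associate of \<open>P\<close> over
  \<open>K(x)\<close> and force \<open>P dvd D\<close>.\<close>

lemma irreducible_bezout_const:
  fixes P :: "'a::field poly poly"
  assumes P: "irreducible P" "degree P > 0" and D: "\<not> P dvd D"
  shows "\<exists>U V r. r \<noteq> 0 \<and> U * P + V * D = [:r:]"
proof -
  define J where "J G \<longleftrightarrow> G \<noteq> 0 \<and> (\<exists>U V. G = U * P + V * D)" for G
  have "J P" using P by (auto simp: J_def intro: exI[of _ 1] exI[of _ 0])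
  \<comment> \<open>\<open>G\<close> has least degree in \<open>y\<close> among the nonzero elements
    of the ideal generated by \<open>P\<close> and \<open>D\<close>; by pseudo-division it divides
    each of them up to a nonzero constant from \<open>K[x]\<close>.\<close>
  then obtain G where G: "J G" and min: "\<And>H. J H \<Longrightarrow> degree G \<le> degree H"
    using ex_has_least_nat[of J P degree] by blast
  obtain U V where UV: "G = U * P + V * D" and G0: "G \<noteq> 0" using G by (auto simp: J_def)
  have pseudo: "\<exists>c Q. c \<noteq> 0 \<and> smult c F = Q * G" if F: "F = A * P + B * D" for F A B
  proof -
    obtain c Q where c: "c \<noteq> 0" "smult c F = G * Q + pseudo_mod F G"
      and deg: "pseudo_mod F G = 0 \<or> degree (pseudo_mod F G) < degree G"
      using pseudo_mod[OF G0] by blast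
    have "pseudo_mod F G = smult c F - G * Q" using c by simp
    also have "\<dots> = (smult c A - U * Q) * P + (smult c B - V * Q) * D"
      by (simp add: F UV algebra_simps smult_add_right)
    finally have "pseudo_mod F G = 0" using deg min unfolding J_def by (metis not_le)
    then show ?thesis using c by (auto simp: mult.commute)
  qed
  obtain c Q where c: "c \<noteq> 0" "smult c P = Q * G" using pseudo[of P 1 0] by auto
  obtain c' Q' where c': "c' \<noteq> 0" "smult c' D = Q' * G" using pseudo[of D 0 1] by auto
  have "degree G = 0"
  proof (rule ccontr)
    assume "degree G \<noteq> 0"
    then have "degree Q = 0" using irreducible_smult_eq_mult[OF P(1) c] by simp
    then obtain e where e: "Q = [:e:]" by (elim degree_eq_zeroE)
    have "e \<noteq> 0" using c P e by auto
    \<comment> \<open>Multiplication by \<open>e\<close> turns the factor \<open>G\<close> of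
      \<open>smult c' D\<close> into \<open>smult c P\<close>.\<close>
    have "smult (e * c') D = Q * (smult c' D)" by (simp add: e mult.commute)
    also have "\<dots> = Q' * (Q * G)" by (simp add: c' mult_ac)
    also have "\<dots> = P * smult c Q'" by (simp flip: c(2) add: mult.commute[of G] mult.commute[of P])
    finally have "P dvd smult (e * c') D" by (metis dvd_triv_left)
    then show False
      using irreducible_dvd_smult_cancel[OF P] \<open>e \<noteq> 0\<close> c'(1) D by (metis no_zero_divisors)
  qed
  then obtain r where r: "G = [:r:]" by (elim degree_eq_zeroE)
  then show ?thesis using UV G0 by (metis pCons_0_0)
qed

section \<open>Irreducible factors at a smooth point\<close>

lemma eval2_mult:
  fixes A B :: "'a::field poly poly"
  shows "eval2 (A * B) x y = eval2 A x y * eval2 B x y"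
    and "eval2 (pderiv (A * B)) x y = eval2 A x y * eval2 (pderiv B) x y + eval2 B x y * eval2 (pderiv A) x y"
  by (simp_all add: eval2_def pderiv_mult)

lemma smooth_point_irreducible_factor:
  fixes P :: "'a::field poly poly"
  assumes "eval2 P a b = 0" "eval2 (pderiv P) a b \<noteq> 0"
  shows "\<exists>R. R dvd P \<and> irreducible R \<and> eval2 R a b = 0 \<and> eval2 (pderiv R) a b \<noteq> 0"
  using assms
proof \<comment> \<open>the measure is additive under multiplication and vanishes only on units and \<open>0\<close>\<close>
  (induction "degree P + degree (lead_coeff P)" arbitrary: P rule: less_induct)
  case less
  have P0: "P \<noteq> 0" using less.prems by (auto simp: eval2_def)
  have nu: "\<not> is_unit P"
    using less.prems by (auto simp: is_unit_poly_iff eval2_def pderiv_pCons)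
  show ?case
  proof (cases "irreducible P")
    case False
    then obtain A B where AB: "P = A * B" "\<not> is_unit A" "\<not> is_unit B"
      using P0 nu False irreducibleI by metis
    have nz: "A \<noteq> 0" "B \<noteq> 0" using AB P0 by auto
    have pos: "degree H + degree (lead_coeff H) > 0" if "H \<noteq> 0" "\<not> is_unit H" for H :: "'a poly poly"
    proof (rule ccontr)
      assume "\<not> ?thesis"
      then obtain h where "H = [:h:]" "degree h = 0" by (auto elim: degree_eq_zeroE)
      then show False using that by (auto simp: is_unit_const_poly_iff is_unit_iff_degree)
    qed
    have lead: "degree (lead_coeff P) = degree (lead_coeff A) + degree (lead_coeff B)"
      using nz unfolding AB(1) lead_coeff_mult by (intro degree_mult_eq) auto
    have "degree P = degree A + degree B" using nz by (simp add: AB(1) degree_mult_eq)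
    then have less: "degree A + degree (lead_coeff A) < degree P + degree (lead_coeff P)"
      "degree B + degree (lead_coeff B) < degree P + degree (lead_coeff P)"
      using pos[OF nz(1) AB(2)] pos[OF nz(2) AB(3)] lead
      by linarith+
    \<comment> \<open>By the product rule \<open>A\<close> and \<open>B\<close> cannot both vanish
      at the point, and the one that does is smooth there.\<close>
    have "eval2 A a b = 0 \<and> eval2 (pderiv A) a b \<noteq> 0 \<or> eval2 B a b = 0 \<and> eval2 (pderiv B) a b \<noteq> 0"
      using less.prems by (auto simp: AB(1) eval2_mult)
    then show ?thesis using less less.hyps AB(1) by (meson dvd_mult dvd_mult2)
  qed (use less.prems dvd_refl in blast)
qed

subsection \<open>Substituting a polynomial for the outer variable\<close>

text \<open>Root counting over the quotient domain modulo \<open>q\<close> without forming the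
  quotient: \<open>P\<close> stays nonzero there, and reduction is injective on
  \<open>S\<close>.\<close>

lemma finite_dvd_poly:
  fixes P :: "'a::idom poly"
  assumes q: "prime_elem q" and "\<not> [:q:] dvd P"
    and S: "\<And>u v. u \<in> S \<Longrightarrow> v \<in> S \<Longrightarrow> q dvd u - v \<Longrightarrow> u = v"
  shows "finite {u \<in> S. q dvd poly P u}"
  using assms(2)
proof (induction "degree P" arbitrary: P rule: less_induct)
  case less
  show ?case
  proof (cases "\<exists>u\<in>S. q dvd poly P u")
    case True
    then obtain u where u: "u \<in> S" "q dvd poly P u" by blast
    \<comment> \<open>The quotient by \<open>y - u\<close> carries the remaining roots modulo
      \<open>q\<close>, since \<open>q\<close> divides the remainder
      \<open>poly P u\<close>.\<close>
    define P' where "P' = synthetic_div P u"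
    have eq: "P = [:-u, 1:] * P' + [:poly P u:]"
      using synthetic_div_correct'[of u P] by (simp add: P'_def)
    have "degree P \<noteq> 0"
    proof
      assume "degree P = 0"
      then obtain c where "P = [:c:]" by (elim degree_eq_zeroE)
      then show False using u less.prems by simp
    qed
    then have "degree P' < degree P" by (simp add: P'_def degree_synthetic_div)
    moreover have "\<not> [:q:] dvd P'"
    proof
      assume "[:q:] dvd P'"
      moreover have "[:q:] dvd [:poly P u:]" using u by simp
      ultimately have "[:q:] dvd [:-u, 1:] * P' + [:poly P u:]" by (intro dvd_add dvd_mult)
      then show False using eq less.prems by simp
    qed
    ultimately have "finite {v \<in> S. q dvd poly P' v}" using less.hyps by blast
    moreover have "{v \<in> S. q dvd poly P v} \<subseteq> insert u {v \<in> S. q dvd poly P' v}"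
    proof
      fix v assume "v \<in> {v \<in> S. q dvd poly P v}"
      then have v: "v \<in> S" "q dvd poly P v" by auto
      have "poly P v = poly ([:-u, 1:] * P' + [:poly P u:]) v" using eq by simp
      then have "(v - u) * poly P' v = poly P v - poly P u" by (simp add: algebra_simps)
      then have "q dvd (v - u) * poly P' v" using u v by (metis dvd_diff)
      then have "q dvd v - u \<or> q dvd poly P' v" using q prime_elem_dvd_multD by blast
      then show "v \<in> insert u {v \<in> S. q dvd poly P' v}" using S u v by blast
    qed
    ultimately show ?thesis by (meson finite_insert finite_subset)
  next
    case False
    then have "{u \<in> S. q dvd poly P u} = {}" by blast
    then show ?thesis by (metis finite.emptyI)
  qed
qed

lemma poly_poly_const: "poly (poly Q g) a = poly (poly Q [:poly g a:]) a"
  by (induction Q) auto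

text \<open>The chain rule for \<open>P(x, g(x))\<close>; \<open>map_poly pderiv P\<close> is the
  partial derivative in the inner variable \<open>x\<close>.\<close>

lemma pderiv_poly:
  fixes P :: "'a::field poly poly"
  shows "pderiv (poly P g) = poly (map_poly pderiv P) g + poly (pderiv P) g * pderiv g"
proof (induction P)
  case (pCons p P)
  have "map_poly pderiv (pCons p P) = pCons (pderiv p) (map_poly pderiv P)"
    using pCons.hyps by (intro map_poly_pCons) auto
  then show ?case using pCons.IH
    by (simp add: pderiv_add pderiv_mult pderiv_pCons algebra_simps)
qed simp

section \<open>Leading terms and coefficients after substitution\<close>

lemma coeff_mult_degree_le:
  fixes f g :: "'a::comm_semiring_0 poly"
  assumes "degree f \<le> m" "degree g \<le> n"
  shows "coeff (f * g) (m + n) = coeff f m * coeff g n"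
proof (cases "degree f = m \<and> degree g = n")
  case True
  then show ?thesis using coeff_mult_degree_sum[of f g] by simp
next
  case False
  then have "degree (f * g) < m + n" and "coeff f m = 0 \<or> coeff g n = 0"
    using assms degree_mult_le[of f g] by (auto intro: coeff_eq_0)
  then show ?thesis by (auto simp: coeff_eq_0)
qed

text \<open>\<open>N\<close> is the weighted degree of \<open>P\<close> for the weights \<open>1\<close> of \<open>x\<close> and \<open>k\<close> of \<open>y\<close>, and
  \<open>L\<close> is the dehomogenised leading form.\<close>
lemma weighted_lead_coeff:
  fixes P :: "'a::field poly poly"
  assumes "P \<noteq> 0"
  shows "\<exists>N L. L \<noteq> 0 \<and> (\<forall>g. degree g \<le> k \<longrightarrow>
           degree (poly P g) \<le> N \<and> coeff (poly P g) N = poly L (coeff g k))"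
  using assms
proof (induction P)
  case (pCons p P)
  show ?case
  proof (cases "P = 0")
    case True
    then show ?thesis using pCons.prems
      by (intro exI[of _ "degree p"] exI[of _ "[:lead_coeff p:]"]) auto
  next
    case False
    then obtain N L where L: "L \<noteq> 0"
      and deg: "\<And>g. degree g \<le> k \<Longrightarrow> degree (poly P g) \<le> N"
      and lc: "\<And>g. degree g \<le> k \<Longrightarrow> coeff (poly P g) N = poly L (coeff g k)"
      using pCons.IH by blast
    have deg': "degree (g * poly P g) \<le> k + N" if "degree g \<le> k" for g
      using that deg[OF that] degree_mult_le[of g "poly P g"] by linarith
    have lc': "coeff (g * poly P g) (k + N) = coeff g k * poly L (coeff g k)" if "degree g \<le> k" for g
      using coeff_mult_degree_le[OF that deg[OF that]] lc[OF that] by simp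
    show ?thesis
    proof (cases "degree p \<le> k + N")
      case True
      \<comment> \<open>If \<open>p\<close> has degree exactly \<open>k + N\<close>, its leading
        coefficient joins the leading form; if the degree is smaller, the added entry is 0.\<close>
      have "pCons (coeff p (k + N)) L \<noteq> 0" using L by simp
      then show ?thesis using deg' lc' True
        by (intro exI[of _ "k + N"] exI[of _ "pCons (coeff p (k + N)) L"])
           (auto intro: degree_add_le)
    next
      case False
      then have "coeff (g * poly P g) (degree p) = 0" if "degree g \<le> k" for g
        using deg'[OF that] by (intro coeff_eq_0) linarith
      moreover have "[:lead_coeff p:] \<noteq> 0" using False by auto
      moreover have "degree (g * poly P g) \<le> degree p" if "degree g \<le> k" for g
        using deg'[OF that] False by linarith
      ultimately show ?thesis
        by (intro exI[of _ "degree p"] exI[of _ "[:lead_coeff p:]"])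
           (auto intro: degree_add_le)
    qed
  qed
qed simp

text \<open>Polynomial dependence on \<open>t\<close> makes the coefficients of the translates
  continuous in every field topology.\<close>

lemma coeff_poly_shift:
  fixes P :: "'a::field poly poly"
  shows "\<exists>c. \<forall>t. coeff (poly P (g + [:t:])) j = poly c t"
proof (induction P arbitrary: j)
  case 0
  show ?case by (auto intro: exI[of _ 0])
next
  case (pCons p P)
  then obtain c where c: "\<And>j t. coeff (poly P (g + [:t:])) j = poly (c j) t" by metis
  have "coeff (poly (pCons p P) (g + [:t:])) j =
      poly ([:coeff p j:] + (\<Sum>i\<le>j. smult (coeff g i) (c (j - i))) + pCons 0 (c j)) t" for t
    by (simp add: c distrib_right coeff_mult poly_sum)
  then show ?case by blast
qed

subsection \<open>Field topologies\<close>

lemma field_topology_continuous_poly: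
  assumes "field_topology T"
  shows "continuous_map T T (poly p)"
proof (induction p)
  case 0
  then show ?case using assms by (simp add: field_topology_def)
next
  case (pCons a p)
  have add: "continuous_map (prod_topology T T) T (\<lambda>(x, y). x + y)"
    and mult: "continuous_map (prod_topology T T) T (\<lambda>(x, y). x * y)"
    and top: "topspace T = UNIV"
    using assms by (auto simp: field_topology_def)
  have "continuous_map T T (\<lambda>x. (\<lambda>(x, y). x * y) (x, poly p x))"
    by (rule continuous_map_compose[OF _ mult, unfolded o_def]) (use pCons in \<open>auto intro: continuous_map_pairedI\<close>)
  then have "continuous_map T T (\<lambda>x. (\<lambda>(x, y). x + y) (a, x * poly p x))"
    by (intro continuous_map_compose[OF _ add, unfolded o_def] continuous_map_pairedI) (simp_all add: top)
  then show ?case by simp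
qed

text \<open>In a finite open set the T1 property would isolate \<open>c\<close>; translations would
  then isolate every point and make the topology discrete.\<close>

lemma field_topology_infinite_nbhd:
  fixes T :: "'a::field topology"
  assumes T: "field_topology T" and U: "openin T U" "c \<in> U"
  shows "infinite U"
proof
  assume "finite U"
  have top: "topspace T = UNIV" and Hd: "Hausdorff_space T" using T by (auto simp: field_topology_def)
  then have t1: "t1_space T" by (simp add: Hausdorff_imp_t1_space)
  have "closedin T (U - {c})" using t1 \<open>finite U\<close> top by (simp add: t1_space_closedin_finite)
  then have "openin T (U - (U - {c}))" using U by blast
  moreover have "U - (U - {c}) = {c}" using U by auto
  ultimately have c: "openin T {c}" by simp
  have "openin T {x}" for x
  proof -
    \<comment> \<open>The translation by \<open>c - x\<close> pulls \<open>{c}\<close> back to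
      \<open>{x}\<close>.\<close>
    have "openin T {y \<in> topspace T. poly [:c - x, 1:] y \<in> {c}}"
      using field_topology_continuous_poly[OF T] c by (rule openin_continuous_map_preimage)
    moreover have "{y \<in> topspace T. poly [:c - x, 1:] y \<in> {c}} = {x}" using top by auto
    ultimately show ?thesis by simp
  qed
  then have "T = discrete_topology UNIV" using top by (metis discrete_topology_unique UNIV_I)
  then show False using T by (simp add: field_topology_def)
qed

lemma continuous_map_monic_topology:
  assumes "\<And>t. t \<in> topspace X \<Longrightarrow> f t \<in> monic_polys d"
    and "\<And>j. j < d \<Longrightarrow> continuous_map X T (\<lambda>t. coeff (f t) j)"
  shows "continuous_map X (monic_topology T d) f"
  unfolding monic_topology_def
proof (rule continuous_map_pullback')
  show "continuous_map X (product_topology (\<lambda>_. T) {..<d}) ((\<lambda>P. restrict (coeff P) {..<d}) \<circ> f)"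
    using assms(2) by (auto simp: continuous_map_componentwise o_def)
  show "topspace X \<subseteq> f -` monic_polys d" using assms(1) by auto
qed

subsection \<open>Generic parabolas through a smooth point\<close>

text \<open>In positive characteristic the degree may drop by more than one; the inequality suffices
  to see that \<open>P\<close> does not divide a nonzero \<open>pderiv P\<close>.\<close>

lemma degree_pderiv_less:
  fixes p :: "'a::{comm_semiring_1,semiring_no_zero_divisors} poly"
  assumes "degree p > 0"
  shows "degree (pderiv p) < degree p"
proof -
  have "degree (pderiv p) \<le> degree p - 1"
    by (rule degree_le) (auto simp: coeff_pderiv intro!: mult_not_zero coeff_eq_0)
  then show ?thesis using assms by simp
qed

text \<open>Modulo a prime not dividing \<open>X\<close>, distinct \<open>s\<close> give distinct
  members of the pencil, so finitely many are roots of \<open>P\<close>. In the application the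
  primes stand for the \<open>x\<close>-coordinates of multiple roots, which avoids an algebraic
  closure.\<close>

lemma finite_dvd_poly_pencil:
  fixes P :: "'a::field poly poly"
  assumes "irreducible P" "degree P > 0" "r \<noteq> 0"
  shows "finite {s. \<exists>q. prime_elem q \<and> q dvd r \<and> \<not> q dvd X \<and> q dvd poly P (h + [:s:] * X\<^sup>2)}"
    (is "finite (?B r)")
  using assms(3)
proof (induction r rule: field_poly_prime_induct)
  case (unit u)
  then have "?B u = {}" by (auto simp: prime_elem_def intro: dvd_trans)
  then show ?case by (metis finite.emptyI)
next
  case (prime q0 r)
  have "finite {s. q0 dvd poly P (h + [:s:] * X\<^sup>2)}" if X: "\<not> q0 dvd X"
  proof -
    let ?g = "\<lambda>s. h + [:s:] * X\<^sup>2"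
    have eq: "s = s'" if "q0 dvd ?g s - ?g s'" for s s'
    proof (rule ccontr)
      assume "s \<noteq> s'"
      have "?g s - ?g s' = [:s - s':] * X\<^sup>2"
        by (simp add: smult_diff_left)
      then have "q0 dvd [:s - s':] \<or> q0 dvd X\<^sup>2"
        using that prime_elem_dvd_multD[OF prime.hyps(1)] by metis
      moreover have "\<not> q0 dvd X\<^sup>2" using X prime.hyps(1) prime_elem_dvd_power by blast
      moreover have "is_unit [:s - s':]" using \<open>s \<noteq> s'\<close> by (simp add: is_unit_const_poly_iff dvd_field_iff)
      ultimately show False using prime.hyps(1) by (meson dvd_trans prime_elem_not_unit)
    qed
    have "finite {u \<in> range ?g. q0 dvd poly P u}"
      using irreducible_not_prime_const_dvd[OF assms(1,2) prime.hyps(1)] eq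
      by (intro finite_dvd_poly[OF prime.hyps(1)]) blast+
    moreover have "inj ?g" using eq by (intro injI) simp
    ultimately have "finite (?g -` {u \<in> range ?g. q0 dvd poly P u})" by (rule finite_vimageI)
    then show ?thesis by (simp add: vimage_def)
  qed
  then have "finite {s. \<not> q0 dvd X \<and> q0 dvd poly P (h + [:s:] * X\<^sup>2)}"
    by (cases "q0 dvd X") auto
  moreover have "?B (q0 * r) \<subseteq> {s. \<not> q0 dvd X \<and> q0 dvd poly P (h + [:s:] * X\<^sup>2)} \<union> ?B r"
  proof
    fix s assume "s \<in> ?B (q0 * r)"
    then obtain q where q: "prime_elem q" "q dvd q0 * r" "\<not> q dvd X" "q dvd poly P (h + [:s:] * X\<^sup>2)"
      by blast
    then consider "q dvd r" | "q dvd q0" using prime_elem_dvd_multD by blast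
    then show "s \<in> {s. \<not> q0 dvd X \<and> q0 dvd poly P (h + [:s:] * X\<^sup>2)} \<union> ?B r"
    proof cases
      \<comment> \<open>A prime dividing a prime is associated to it, so the conditions on
        \<open>q\<close> transfer to \<open>q0\<close>.\<close>
      case 2
      then have "q0 dvd q"
        using irreducibleD' prime_elem_imp_irreducible prime.hyps(1) q(1) prime_elem_not_unit by blast
      then have "\<not> q0 dvd X" "q0 dvd poly P (h + [:s:] * X\<^sup>2)"
        using q(3,4) 2 dvd_trans by blast+
      then show ?thesis by blast
    qed (use q in blast)
  qed
  ultimately show ?case using prime.IH by (meson finite_UnI finite_subset)
qed

lemma generic_parabola_separable:
  fixes P :: "'a::field poly poly"
  assumes inf: "infinite (UNIV :: 'a set)"
    and irr: "irreducible P" and smooth: "eval2 (pderiv P) a b \<noteq> 0"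
  shows "\<exists>m. finite {s. \<not> separable_poly
    (poly P ([:b:] + [:m:] * [:-a, 1:] + [:s:] * [:-a, 1:]\<^sup>2))}"
proof -
  define X where "X = [:-a, 1:]"
  define g where "g m s = [:b:] + [:m:] * X + [:s:] * X\<^sup>2" for m s
  define Px Py where "Px = map_poly pderiv P" and "Py = pderiv P"
  \<comment> \<open>For \<open>g = g m s\<close> one has \<open>X g' = 2 (g - b) - m X\<close>, so
    \<open>D m\<close> at \<open>y = g\<close> is \<open>X\<close> times the derivative of
    \<open>P(x, g)\<close>.\<close>
  define D where "D m = [:X:] * Px + [:- 2 * [:b:] - [:m:] * X, 2:] * Py" for m
  have Py0: "Py \<noteq> 0" using smooth by (auto simp: Py_def eval2_def)
  then have deg: "degree P > 0" by (auto simp: Py_def pderiv_pCons elim: degree_eq_zeroE intro!: gr0I)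
  have P_Py: "\<not> P dvd Py"
    using dvd_imp_degree_le[of P Py] Py0 degree_pderiv_less[OF deg] by (auto simp: Py_def)
  have fin: "finite {m. R m}" if "\<And>m m'. R m \<Longrightarrow> R m' \<Longrightarrow> m = m'" for R :: "'a \<Rightarrow> bool"
  proof (cases "\<exists>m. R m")
    case True
    then obtain m where "R m" by blast
    then have "{m. R m} \<subseteq> {m}" using that by blast
    then show ?thesis by (rule finite_subset) simp
  qed simp
  have "finite {m. P dvd D m}"
  proof (rule fin, rule ccontr)
    fix m m' assume dvd: "P dvd D m" "P dvd D m'" and ne: "m \<noteq> m'"
    have "D m - D m' = [:[:m' - m:] * X:] * Py"
      by (simp add: D_def algebra_simps smult_diff_left flip: smult_diff_right)
    then have "P dvd smult ([:m' - m:] * X) Py" using dvd_diff[OF dvd] by simp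
    moreover have "[:m' - m:] * X \<noteq> 0" using ne by (simp add: X_def)
    ultimately show False using irreducible_dvd_smult_cancel[OF irr deg] P_Py by blast
  qed
  \<comment> \<open>This sum is the derivative of \<open>P(x, g)\<close> at \<open>a\<close>,
    whatever \<open>s\<close> is; avoiding its zero keeps \<open>X\<close> from dividing the
    derivative.\<close>
  moreover have "finite {m. eval2 Px a b + m * eval2 Py a b = 0}"
  proof (rule fin)
    fix m m' assume "eval2 Px a b + m * eval2 Py a b = 0" "eval2 Px a b + m' * eval2 Py a b = 0"
    then have "m * eval2 Py a b = m' * eval2 Py a b" by (metis add_left_cancel)
    then show "m = m'" using smooth by (simp add: Py_def)
  qed
  ultimately have "finite ({m. P dvd D m} \<union> {m. eval2 Px a b + m * eval2 Py a b = 0})" by blast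
  then obtain m where m: "\<not> P dvd D m" "eval2 Px a b + m * eval2 Py a b \<noteq> 0"
    using ex_new_if_finite[OF inf] by blast
  have eval: "poly (poly Q (g m s)) a = eval2 Q a b" for Q s
    by (subst poly_poly_const) (simp add: eval2_def g_def X_def)
  have dX: "pderiv X = 1" by (simp add: X_def pderiv_pCons)
  have dg: "pderiv (g m s) = [:m:] + [:s:] * (X + X)" for s
    by (simp add: g_def pderiv_add pderiv_mult pderiv_smult pderiv_pCons dX power2_eq_square)
  have dF: "pderiv (poly P (g m s)) = poly Px (g m s) + poly Py (g m s) * pderiv (g m s)" for s
    by (simp add: pderiv_poly Px_def Py_def)
  have dFa: "poly (pderiv (poly P (g m s))) a \<noteq> 0" for s
    unfolding dF dg using m(2) by (simp add: eval X_def algebra_simps)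
  have XdF: "X * pderiv (poly P (g m s)) = poly (D m) (g m s)" for s
  proof -
    have X_dg: "X * pderiv (g m s) = - 2 * [:b:] - [:m:] * X + 2 * g m s"
      unfolding dg unfolding g_def by (simp only: power2_eq_square) algebra
    have "poly (D m) (g m s) =
        X * poly Px (g m s) + (- 2 * [:b:] - [:m:] * X + 2 * g m s) * poly Py (g m s)"
      unfolding D_def by (simp add: algebra_simps)
    then have "poly (D m) (g m s) = X * poly Px (g m s) + X * pderiv (g m s) * poly Py (g m s)"
      by (simp only: X_dg)
    then show ?thesis unfolding dF by (simp only: distrib_left mult_ac)
  qed
  \<comment> \<open>\<open>r\<close> is independent of \<open>s\<close>, so its primes are a fixed
    list of candidates for common factors of \<open>P(x, g)\<close> and its derivative.\<close>
  obtain U V r where r: "r \<noteq> 0" "U * P + V * D m = [:r:]"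
    using irreducible_bezout_const[OF irr deg m(1)] by blast
  have "{s. \<not> separable_poly (poly P (g m s))} \<subseteq>
      {s. \<exists>q. prime_elem q \<and> q dvd r \<and> \<not> q dvd X \<and> q dvd poly P ([:b:] + [:m:] * X + [:s:] * X\<^sup>2)}"
  proof
    fix s assume "s \<in> {s. \<not> separable_poly (poly P (g m s))}"
    then obtain d where d: "d dvd poly P (g m s)" "d dvd pderiv (poly P (g m s))" "\<not> is_unit d"
      by (auto simp: separable_poly_def coprime_def)
    moreover have "d \<noteq> 0" using d(2) dFa[of s] by auto
    ultimately obtain q where "prime_elem q" "q dvd d" using field_poly_prime_divisor_exists by blast
    then have q: "prime_elem q" "q dvd poly P (g m s)" "q dvd pderiv (poly P (g m s))"
      using d dvd_trans by blast+
    have "\<not> q dvd X"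
    proof
      assume "q dvd X"
      moreover have "irreducible X" unfolding X_def by (rule irreducible_linear_field_poly) simp
      ultimately have "X dvd q" using irreducibleD' prime_elem_not_unit q(1) by blast
      then have "X dvd pderiv (poly P (g m s))" using q(3) dvd_trans by blast
      then show False using dFa[of s] by (simp add: X_def poly_eq_0_iff_dvd)
    qed
    moreover have "q dvd poly (U * P + V * D m) (g m s)"
      using q(2,3) by (simp flip: XdF)
    then have "q dvd r" by (simp add: r(2))
    ultimately show "s \<in> {s. \<exists>q. prime_elem q \<and> q dvd r \<and> \<not> q dvd X \<and>
        q dvd poly P ([:b:] + [:m:] * X + [:s:] * X\<^sup>2)}"
      using q(1,2) unfolding g_def by blast
  qed
  then have "finite {s. \<not> separable_poly (poly P (g m s))}"
    using finite_dvd_poly_pencil[OF irr deg r(1)] by (rule finite_subset)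
  then show ?thesis unfolding g_def X_def by blast
qed

section \<open>Roots along the translates of a generic parabola\<close>

theorem theorem2p9:
  fixes T :: "'a::field topology"
  assumes "field_topology T"
    and "bronze_t_henselian T"
  shows "large_field TYPE('a)"
  unfolding large_field_def
proof (intro allI impI, elim conjE)
  fix P :: "'a poly poly" and a b
  assume "eval2 P a b = 0" "eval2 (pderiv P) a b \<noteq> 0"
  then obtain R where R: "R dvd P" "irreducible R" "eval2 R a b = 0" "eval2 (pderiv R) a b \<noteq> 0"
    using smooth_point_irreducible_factor by blast
  have top: "topspace T = UNIV" using assms(1) by (simp add: field_topology_def)
  have inf: "infinite (UNIV :: 'a set)"
    using field_topology_infinite_nbhd[OF assms(1), of UNIV] by (metis UNIV_I openin_topspace top)
  define g where "g m s = [:b:] + [:m:] * [:-a, 1:] + [:s:] * [:-a, 1:]\<^sup>2" for m s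
  have g_coeffs: "g m s = [:b - m * a + s * a\<^sup>2, m - 2 * s * a, s:]" for m s
    by (simp add: g_def power2_eq_square algebra_simps)
  obtain m where m: "finite {s. \<not> separable_poly (poly R (g m s))}"
    using generic_parabola_separable[OF inf R(2,4)] unfolding g_def by blast
  have "R \<noteq> 0" using R(2) by auto
  then obtain N L where "L \<noteq> 0"
    and N: "\<And>h. degree h \<le> 2 \<Longrightarrow> degree (poly R h) \<le> N"
    and L: "\<And>h. degree h \<le> 2 \<Longrightarrow> coeff (poly R h) N = poly L (coeff h 2)"
    using weighted_lead_coeff[of R 2] by blast
  \<comment> \<open>Where \<open>L\<close> does not vanish at \<open>s\<close>, every
    \<open>R(x, g + t)\<close> has degree \<open>N\<close> and leading coefficient
    \<open>poly L s\<close>, because \<open>t\<close> does not affect the quadratic coefficient of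
    \<open>g + t\<close>.\<close>
  then have "finite ({s. \<not> separable_poly (poly R (g m s))} \<union> {s. poly L s = 0})"
    using m poly_roots_finite by blast
  then obtain s where s: "separable_poly (poly R (g m s))" "poly L s \<noteq> 0"
    using ex_new_if_finite[OF inf] by blast
  define Q where "Q t = smult (inverse (poly L s)) (poly R (g m s + [:t:]))" for t
  have g_deg: "degree (g m s + [:t:]) \<le> 2" "coeff (g m s + [:t:]) 2 = s" for t
    by (simp_all add: g_coeffs numeral_2_eq_2)
  have Q_monic: "Q t \<in> monic_polys N" for t
  proof -
    have "coeff (Q t) N = 1" using L[OF g_deg(1)] s(2) unfolding g_deg(2) by (simp add: Q_def)
    moreover have "degree (Q t) \<le> N" using N[OF g_deg(1)] s(2) by (simp add: Q_def)
    ultimately have "degree (Q t) = N" by (simp add: le_antisym le_degree)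
    then show ?thesis using \<open>coeff (Q t) N = 1\<close> by (simp add: monic_polys_def)
  qed
  have "continuous_map T T (\<lambda>t. coeff (Q t) j)" for j
  proof -
    obtain c where "\<And>t. coeff (poly R (g m s + [:t:])) j = poly c t" using coeff_poly_shift by blast
    then have "(\<lambda>t. coeff (Q t) j) = poly (smult (inverse (poly L s)) c)" by (simp add: Q_def fun_eq_iff)
    then show ?thesis by (simp add: field_topology_continuous_poly[OF assms(1)] del: poly_smult)
  qed
  then have cont: "continuous_map T (monic_topology T N) Q"
    by (intro continuous_map_monic_topology Q_monic)
  have "separable_poly (Q 0)"
  proof -
    have "is_unit c" if "c dvd Q 0" "c dvd pderiv (Q 0)" for c
    proof -
      have "c dvd poly R (g m s)" "c dvd pderiv (poly R (g m s))"
        using that s(2) by (simp_all add: Q_def pderiv_smult dvd_smult_iff)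
      then show ?thesis using s(1) unfolding separable_poly_def by (rule coprime_common_divisor[rotated])
    qed
    then show ?thesis unfolding separable_poly_def by (rule coprimeI)
  qed
  moreover have "poly (Q 0) a = 0"
  proof -
    have "poly (poly R (g m s)) a = eval2 R a b"
      by (subst poly_poly_const) (simp add: eval2_def g_def)
    then show ?thesis using R(3) by (simp add: Q_def)
  qed
  ultimately obtain V where V: "openin (monic_topology T N) V" "Q 0 \<in> V" "\<And>p. p \<in> V \<Longrightarrow> \<exists>x. poly p x = 0"
    using assms(2) Q_monic unfolding bronze_t_henselian_def by meson
  define W where "W = {t \<in> topspace T. Q t \<in> V}"
  have "openin T W" unfolding W_def using cont V(1) by (rule openin_continuous_map_preimage)
  moreover have "0 \<in> W" using V(2) by (simp add: W_def top)
  ultimately have "infinite W" using field_topology_infinite_nbhd[OF assms(1)] by blast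
  have "\<forall>t\<in>W. \<exists>x. poly (Q t) x = 0" using V(3) by (simp add: W_def)
  then obtain z where z: "\<And>t. t \<in> W \<Longrightarrow> poly (Q t) (z t) = 0" by metis
  \<comment> \<open>Subtracting the value of \<open>g m s\<close> at the first coordinate from the
    second recovers \<open>t\<close>, so \<open>h\<close> is injective.\<close>
  define h where "h t = (z t, poly (g m s) (z t) + t)" for t
  have "inj_on h W" by (auto simp: inj_on_def h_def)
  then have "infinite (h ` W)" using \<open>infinite W\<close> by (simp add: finite_image_iff)
  moreover have "h ` W \<subseteq> {(x, y). eval2 P x y = 0}"
  proof safe
    fix t x y assume t: "t \<in> W" and xy: "(x, y) = h t"
    have "poly (poly R (g m s + [:t:])) (z t) = 0" using z[OF t] s(2) by (simp add: Q_def)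
    then have "eval2 R x y = 0"
      using xy poly_poly_const[of R "g m s + [:t:]" "z t"] by (simp add: eval2_def h_def)
    then show "eval2 P x y = 0" using R(1) by (auto simp: eval2_mult elim!: dvdE)
  qed
  ultimately show "infinite {(x, y). eval2 P x y = 0}" using finite_subset by blast
qed

end
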